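(* Let $\gamma\geq\beta>0$ be real numbers such that $4\gamma-\beta\geq 1$. Let $p$ be analytic in $\mathbb{D}$ with $p(0)=1$. If $$\gamma zp'(z)+\beta z^2p''(z)\prec\frac{z}{8\sqrt{2}},$$ then $p(z)\prec\sqrt{1+z}$.
   Context: $\mathbb{D}=\{z\in\mathbb{C}:|z|<1\}$. For analytic $f,g$ on $\mathbb{D}$, $f\prec g$ ($f$ is subordinate to $g$) means there is an analytic $w:\mathbb{D}\to\mathbb{D}$ with $w(0)=0$ and $f(z)=g(w(z))$ for all $z\in\mathbb{D}$. $\sqrt{1+z}$ is the principal branch; it maps $\mathbb{D}$ univalently onto $\{w:|w^2-1|<1,\ \operatorname{Re}w>0\}$. *)

theory Defs
  imports "HOL-Complex_Analysis.Complex_Analysis"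
begin

abbreviation unit_disc :: "complex set" where
  "unit_disc \<equiv> ball 0 1"

text \<open>
  As usual, subordination is only meant for functions analytic on the unit disc;
  analyticity of \<open>f\<close> and \<open>g\<close> is not part of the relation itself.
\<close>
definition subordinate :: "(complex \<Rightarrow> complex) \<Rightarrow> (complex \<Rightarrow> complex) \<Rightarrow> bool"
    (infix "\<prec>\<^sub>s" 50) where
  "f \<prec>\<^sub>s g \<longleftrightarrow>
     (\<exists>w. w analytic_on unit_disc \<and> w ` unit_disc \<subseteq> unit_disc \<and> w 0 = 0 \<and>
          (\<forall>z\<in>unit_disc. f z = g (w z)))"

end

theory Submission
  imports Defs
begin

text \<open>
  Dividing the hypothesis by \<open>z\<close> and applying the Schwarz lemma gives
  \<open>|\<gamma> p' + \<beta> z p''| \<le> M\<close> with \<open>M = 1/(8\<surd>2)\<close>. Along a ray this expression is, up to a factor,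
  the derivative of \<open>t powr (\<gamma>/\<beta>) p'(tz)\<close>, so integration gives \<open>|p'| \<le> M/\<gamma>\<close>. As
  \<open>\<gamma> > 1/4\<close>, we get \<open>|p - 1| < 1/(2\<surd>2) < \<surd>2 - 1\<close>, hence \<open>|p\<^sup>2 - 1| < 1\<close>, and \<open>p\<^sup>2 - 1\<close> is the
  required Schwarz function.
\<close>

text \<open>With \<open>c = a / b\<close>, the factor \<open>t powr (c - 1) / b\<close> turns the
  operator at \<open>t z\<close> into the exact derivative of \<open>t powr c * f (t z)\<close> in
  \<open>t\<close>. The comparison function \<open>M / a * t powr c\<close> has the matching
  derivative, so its increment over [0,1] is the bound.\<close>

lemma norm_le_of_euler_operator_bound:
  fixes f :: "complex \<Rightarrow> complex" and a b M :: real
  assumes f: "f holomorphic_on ball 0 R" and pos: "a > 0" "b > 0"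
    and bound: "\<And>z. z \<in> ball 0 R \<Longrightarrow> norm (of_real a * f z + of_real b * z * deriv f z) \<le> M"
    and z: "z \<in> ball 0 R"
  shows "norm (f z) \<le> M / a"
proof -
  define c where "c = a / b"
  have c: "c > 0" using pos by (simp add: c_def)
  have ray: "of_real t * z \<in> ball 0 R" if "0 \<le> t" "t \<le> 1" for t :: real
    using z that mult_right_mono[of t 1 "norm z"] by (auto simp: norm_mult)
  define F where "F = (\<lambda>t::real. of_real (t powr c) * f (of_real t * z))"
  define F' where "F' = (\<lambda>t::real. of_real (t powr (c - 1) / b)
      * (of_real a * f (of_real t * z) + of_real b * (of_real t * z) * deriv f (of_real t * z)))"
  \<comment> \<open>\<open>F 0 = 0\<close> because \<open>c > 0\<close>, so the left side is the
    norm of \<open>f z\<close>. Derivatives are needed only for 0 < t < 1, which avoids the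
    singularity of \<open>t powr (c - 1)\<close> at 0 when \<open>c < 1\<close>.\<close>
  have "norm (F 1 - F 0) \<le> M / a * 1 powr c - M / a * 0 powr c"
  proof (rule differentiable_bound_general[where f' = F' and \<phi>' = "\<lambda>t. M / b * t powr (c - 1)"])
    have "continuous_on {0..1} (\<lambda>t::real. f (of_real t * z))"
      using ray
      by (intro continuous_on_compose2[OF holomorphic_on_imp_continuous_on[OF f]] continuous_intros)
         auto
    then show "continuous_on {0..1} F"
      unfolding F_def using c by (intro continuous_intros continuous_on_powr') auto
    show "continuous_on {0..1} (\<lambda>t. M / a * t powr c)"
      using c by (intro continuous_intros continuous_on_powr') auto
  next
    fix t :: real assume t: "0 < t" "t < 1"
    have df: "(f has_field_derivative deriv f (of_real t * z)) (at (of_real t * z))"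
      using holomorphic_derivI[OF f open_ball ray] t by simp
    have "((\<lambda>s. f (s * z)) has_field_derivative deriv f (of_real t * z) * z) (at (of_real t))"
      by (rule DERIV_chain2[where f = f and g = "\<lambda>s. s * z", OF df]) (auto intro!: derivative_eq_intros)
    then have 1: "((\<lambda>s::real. f (of_real s * z)) has_vector_derivative
        deriv f (of_real t * z) * z) (at t)"
      by (rule has_vector_derivative_real_field)
    have "((\<lambda>s. s powr c) has_real_derivative c * t powr (c - 1)) (at t)"
      using t by (auto intro!: derivative_eq_intros)
    then have 2: "((\<lambda>s. complex_of_real (s powr c)) has_vector_derivative
        of_real (c * t powr (c - 1))) (at t)"
      by (intro has_vector_derivative_of_real)
         (simp add: has_real_derivative_iff_has_vector_derivative)
    have "t powr c = t * t powr (c - 1)"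
      using t by (simp add: powr_diff)
    then have "F' t = of_real (t powr c) * (deriv f (of_real t * z) * z)
        + of_real (c * t powr (c - 1)) * f (of_real t * z)"
      using pos by (simp add: F'_def c_def field_simps)
    then show "(F has_vector_derivative F' t) (at t)"
      unfolding F_def using has_vector_derivative_mult[OF 2 1] by simp
    show "((\<lambda>t. M / a * t powr c) has_vector_derivative M / b * t powr (c - 1)) (at t)"
      unfolding has_real_derivative_iff_has_vector_derivative[symmetric]
      using t pos by (auto intro!: derivative_eq_intros simp: c_def)
    show "norm (F' t) \<le> M / b * t powr (c - 1)"
      using mult_left_mono[OF bound[OF ray[of t]], of "t powr (c - 1) / b"] t pos
      by (simp add: F'_def norm_mult mult.commute norm_divide)
  qed simp
  then show ?thesis
    using c by (simp add: F_def)
qed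

text \<open>Away from 0 this is the Schwarz bound on \<open>w\<close> divided by the norm of
  \<open>z\<close>; at 0 the value \<open>h 0\<close> is the derivative of \<open>w\<close>. Having
  \<open>h\<close> given as holomorphic avoids a removable singularity.\<close>

lemma Schwarz_quotient_bound:
  assumes w: "w holomorphic_on ball 0 1" "w 0 = 0" "\<And>z. norm z < 1 \<Longrightarrow> norm (w z) < 1"
    and h: "h holomorphic_on ball 0 1"
    and eq: "\<And>z. z \<in> ball 0 1 \<Longrightarrow> w z = z * h z"
    and z: "z \<in> ball 0 1"
  shows "norm (h z) \<le> 1"
proof (cases "z = 0")
  case True
  have "((\<lambda>z. z * h z) has_field_derivative h 0) (at 0)"
    using holomorphic_derivI[OF h open_ball, of 0] by (auto intro!: derivative_eq_intros)
  then have "(w has_field_derivative h 0) (at 0)"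
    by (rule has_field_derivative_transform_within_open[where S = "ball 0 1"]) (auto simp: eq)
  then show ?thesis
    using Schwarz_Lemma(2)[OF w, of 0] True by (simp add: DERIV_imp_deriv)
next
  case False
  then show ?thesis
    using Schwarz_Lemma(1)[OF w, of z] z eq[OF z] by (simp add: norm_mult)
qed

text \<open>The disc about 1 of radius \<open>sqrt 2 - 1\<close> lies in the image of the unit disc
  under \<open>csqrt (1 + z)\<close>. The radius is the largest possible, since
  \<open>sqrt 2\<close> is a boundary point of that image.\<close>

lemma subordinate_csqrt:
  assumes p: "p analytic_on unit_disc" "p 0 = 1"
    and bound: "\<And>z. z \<in> unit_disc \<Longrightarrow> norm (p z - 1) < sqrt 2 - 1"
  shows "p \<prec>\<^sub>s (\<lambda>z. csqrt (1 + z))"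
  unfolding subordinate_def
proof (intro exI[of _ "\<lambda>z. (p z)\<^sup>2 - 1"] conjI ballI)
  show "(\<lambda>z. (p z)\<^sup>2 - 1) analytic_on unit_disc"
    by (intro analytic_intros p)
  show "(p 0)\<^sup>2 - 1 = 0"
    using p by simp
  show "(\<lambda>z. (p z)\<^sup>2 - 1) ` unit_disc \<subseteq> unit_disc"
  proof (rule image_subsetI)
    fix z :: complex assume z: "z \<in> unit_disc"
    define r where "r = norm (p z - 1)"
    \<comment> \<open>Writing \<open>p z + 1\<close> as \<open>(p z - 1) + 2\<close> makes the bound
      depend on \<open>r\<close> alone.\<close>
    have "(p z)\<^sup>2 - 1 = (p z - 1) * ((p z - 1) + 2)"
      by (simp add: algebra_simps power2_eq_square)
    then have "norm ((p z)\<^sup>2 - 1) \<le> r * (r + 2)"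
      using norm_triangle_ineq[of "p z - 1" 2] by (simp only: norm_mult r_def mult_left_mono
        norm_ge_zero norm_numeral)
    also have "\<dots> = (r + 1)\<^sup>2 - 1"
      by (simp add: algebra_simps power2_eq_square)
    also have "\<dots> < (sqrt 2)\<^sup>2 - 1"
      using bound[OF z] unfolding r_def by (intro diff_strict_right_mono power_strict_mono) auto
    finally show "(p z)\<^sup>2 - 1 \<in> unit_disc"
      by simp
  qed
  fix z :: complex assume z: "z \<in> unit_disc"
  \<comment> \<open>A positive real part makes \<open>p z\<close> the principal root of its
    square.\<close>
  have "norm (p z - 1) < 1"
    using bound[OF z] sqrt2_less_2 by linarith
  then have "Re (p z) > 0"
    using abs_Re_le_cmod[of "p z - 1"] by simp
  then show "p z = csqrt (1 + ((p z)\<^sup>2 - 1))"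
    by (simp add: csqrt_square)
qed

theorem lemma4p5:
  fixes \<gamma> \<beta> :: real and p :: "complex \<Rightarrow> complex"
  assumes "\<gamma> \<ge> \<beta>" and "\<beta> > 0" and "4 * \<gamma> - \<beta> \<ge> 1"
    and "p analytic_on unit_disc" and "p 0 = 1"
    and "(\<lambda>z. of_real \<gamma> * z * deriv p z + of_real \<beta> * z\<^sup>2 * (deriv ^^ 2) p z)
           \<prec>\<^sub>s (\<lambda>z. z / of_real (8 * sqrt 2))"
  shows "p \<prec>\<^sub>s (\<lambda>z. csqrt (1 + z))"
proof -
  define K where "K = 8 * sqrt (2::real)"
  have K: "K > 0" by (simp add: K_def)
  have \<gamma>: "\<gamma> > 1 / 4" using assms(2,3) by linarith
  have p: "p holomorphic_on unit_disc"
    using assms(4) by (rule analytic_imp_holomorphic)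
  have dp: "deriv p holomorphic_on unit_disc" and ddp: "deriv (deriv p) holomorphic_on unit_disc"
    using p by (auto intro: holomorphic_deriv)
  \<comment> \<open>The left side of the subordination is \<open>z * h z\<close>, so
    \<open>K * h\<close> is the quotient of the Schwarz function \<open>w\<close> by
    \<open>z\<close>.\<close>
  define h where "h = (\<lambda>z. of_real \<gamma> * deriv p z + of_real \<beta> * z * deriv (deriv p) z)"
  obtain w where w: "w analytic_on unit_disc" "w ` unit_disc \<subseteq> unit_disc" "w 0 = 0"
    and eq: "\<And>z. z \<in> unit_disc \<Longrightarrow> of_real \<gamma> * z * deriv p z
        + of_real \<beta> * z\<^sup>2 * (deriv ^^ 2) p z = w z / of_real K"
    using assms(6) unfolding subordinate_def K_def by blast
  have h_bound: "norm (h z) \<le> 1 / K" if z: "z \<in> unit_disc" for z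
  proof -
    have "norm (of_real K * h z) \<le> 1"
    proof (rule Schwarz_quotient_bound[OF analytic_imp_holomorphic[OF w(1)] w(3) _ _ _ z])
      show "norm (w z) < 1" if "norm z < 1" for z
        using w(2) that by (metis dist_0_norm image_subset_iff mem_ball)
      show "(\<lambda>z. of_real K * h z) holomorphic_on unit_disc"
        unfolding h_def by (intro holomorphic_intros dp ddp)
      show "w z = z * (of_real K * h z)" if "z \<in> unit_disc" for z
        using eq[OF that] K by (simp add: h_def numeral_2_eq_2 field_simps)
    qed
    then show ?thesis
      using K by (simp add: norm_mult field_simps)
  qed
  have dp_bound: "norm (deriv p z) \<le> 1 / K / \<gamma>" if "z \<in> unit_disc" for z
    using norm_le_of_euler_operator_bound[OF dp _ assms(2) h_bound[unfolded h_def] that] \<gamma>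
    by simp
  show ?thesis
  proof (rule subordinate_csqrt[OF assms(4,5)])
    fix z :: complex assume z: "z \<in> unit_disc"
    have "norm (p z - p 0) \<le> 1 / K / \<gamma> * norm (z - 0)"
    proof (rule field_differentiable_bound[OF convex_ball _ dp_bound z])
      show "(p has_field_derivative deriv p z) (at z within unit_disc)" if "z \<in> unit_disc" for z
        using holomorphic_derivI[OF p open_ball that] by (rule has_field_derivative_at_within)
    qed auto
    also have "\<dots> \<le> 1 / K / \<gamma>"
      using z K \<gamma> by (intro mult_left_le) auto
    \<comment> \<open>Strictness enters here, from \<open>\<gamma> > 1 / 4\<close>.\<close>
    also have "\<dots> < 4 / K"
      using K \<gamma> by (simp add: field_simps)
    also have "\<dots> = sqrt 2 / 4"
      by (simp add: K_def field_simps)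
    also have "\<dots> < sqrt 2 - 1"
    proof -
      \<comment> \<open>The claim rearranges to \<open>1 < 3 / 4 * sqrt 2\<close>, and 16/9 <
        2.\<close>
      have "4 / 3 < sqrt (2::real)"
        by (rule real_less_rsqrt) (simp add: power2_eq_square)
      then show ?thesis by simp
    qed
    finally show "norm (p z - 1) < sqrt 2 - 1"
      using assms(5) by simp
  qed
qed

end
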